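(* Let $f\colon\mathbb{R}\to\mathbb{R}$ be a generalized monomial of an even degree $m$, fulfilling $f(x)f(y)\ge 0$ for all $(x,y)\in D$, where $D\subseteq\mathbb{R}^2$ is a Borel set such that either $D\notin\mathcal{M}\otimes\mathcal{N}$ or $D\notin\mathcal{N}\otimes\mathcal{M}$. Then $f(x)f(y)\ge 0$ holds for all $(x,y)\in\mathbb{R}^2$.
   Context: Generalized monomials: for $m\ge 1$, a function $F\colon\mathbb{R}^m\to\mathbb{C}$ is $m$-additive if it is additive in each variable separately (no continuity or regularity is assumed). A function $f$ on $\mathbb{R}$ is a generalized monomial of degree $m\ge 1$ if $f(x)=F(x,x,\dots,x)$ ($m$ arguments) for all $x\in\mathbb{R}$, for some non-zero symmetric $m$-additive function $F\colon\mathbb{R}^m\to\mathbb{C}$; here $f$ is assumed real-valued. Constant functions are called generalized monomials of degree $0$. The even degree $m$ may be $0$. Ideals: $\mathcal{M}$ denotes the $\sigma$-ideal of meager subsets of $\mathbb{R}$ and $\mathcal{N}$ the $\sigma$-ideal of Lebesgue null subsets of $\mathbb{R}$. For $B\subseteq\mathbb{R}^2$ and $x\in\mathbb{R}$ let $B_x:=\{y\in\mathbb{R}\colon (x,y)\in B\}$. For $\sigma$-ideals $\mathcal{I},\mathcal{J}$ of subsets of $\mathbb{R}$, the Fubini product $\mathcal{I}\otimes\mathcal{J}$ is the family of all sets $A\subseteq\mathbb{R}^2$ for which there exists a Borel set $B\subseteq\mathbb{R}^2$ with $A\subseteq B$ and $\{x\in\mathbb{R}\colon B_x\notin\mathcal{J}\}\in\mathcal{I}$.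 *)

theory Defs
  imports "HOL-Analysis.Analysis"
begin

text \<open>
  Points of \<open>\<real>\<^sup>m\<close> are lists of length \<open>m\<close>; the values of \<open>F\<close> on lists of any other length
  are irrelevant below.
\<close>

definition multi_additive :: "nat \<Rightarrow> (real list \<Rightarrow> complex) \<Rightarrow> bool" where
  "multi_additive m F \<longleftrightarrow>
    (\<forall>xs i y z. length xs = m \<and> i < m \<longrightarrow>
       F (xs[i := y + z]) = F (xs[i := y]) + F (xs[i := z]))"

definition symmetric_on_lists :: "nat \<Rightarrow> (real list \<Rightarrow> complex) \<Rightarrow> bool" where
  "symmetric_on_lists m F \<longleftrightarrow>
    (\<forall>xs p. length xs = m \<and> p permutes {..<m} \<longrightarrow> F (permute_list p xs) = F xs)"

text \<open>
  In degree \<open>0\<close> all constant functions are allowed, including the zero function.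
\<close>

definition generalized_monomial :: "nat \<Rightarrow> (real \<Rightarrow> complex) \<Rightarrow> bool" where
  "generalized_monomial m f \<longleftrightarrow>
    (if m = 0 then \<exists>c. \<forall>x. f x = c
     else \<exists>F. multi_additive m F \<and> symmetric_on_lists m F \<and>
            (\<exists>xs. length xs = m \<and> F xs \<noteq> 0) \<and>
            (\<forall>x. f x = F (replicate m x)))"

definition nowhere_dense :: "'a::topological_space set \<Rightarrow> bool" where
  "nowhere_dense A \<longleftrightarrow> interior (closure A) = {}"

definition meager_sets :: "'a::topological_space set set" where
  "meager_sets = {A. \<exists>N :: nat \<Rightarrow> 'a set. (\<forall>n. nowhere_dense (N n)) \<and> A = (\<Union>n. N n)}"

definition fubini_product :: "real set set \<Rightarrow> real set set \<Rightarrow> (real \<times> real) set set" where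
  "fubini_product I J =
    {A. \<exists>B \<in> sets borel. A \<subseteq> B \<and> {x. {y. (x, y) \<in> B} \<notin> J} \<in> I}"

end

theory Submission
  imports Defs
begin

text \<open>
  Nonzero rational scaling of either variable preserves the sign of \<open>f x * f y\<close>, as \<open>m\<close> is even,
  so \<open>D\<close> may be saturated under it. Borel sets invariant under rational scaling obey a zero-one law
  for both ideals; since \<open>{x. D\<^sub>x \<notin> \<J>}\<close> is Borel and not in \<open>\<I>\<close>, its complement lies in \<open>\<I>\<close>,
  and every \<open>D\<^sub>x \<notin> \<J>\<close> has its complement in \<open>\<J>\<close>. A set with complement in a
  translation-invariant \<open>\<sigma>\<close>-ideal contains a progression \<open>x + n * a\<close> for each \<open>a\<close>, and
  \<open>f (x + n * a) / n ^ m \<longlonglongrightarrow> f a\<close>; hence it meets \<open>{f > 0}\<close> and \<open>{f < 0}\<close> as soon as these are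
  nonempty, which contradicts \<open>f x * f y \<ge> 0\<close> on \<open>D\<close>.
\<close>

section \<open>Generalized monomials\<close>

lemma multi_additive_Cons:
  assumes "multi_additive (Suc m) F"
  shows "multi_additive m (\<lambda>xs. F (z # xs))"
  unfolding multi_additive_def
proof (intro allI impI)
  fix xs :: "real list" and i y w
  assume "length xs = m \<and> i < m"
  then show "F (z # xs[i := y + w]) = F (z # xs[i := y]) + F (z # xs[i := w])"
    using assms[unfolded multi_additive_def, rule_format, of "z # xs" "Suc i" y w] by simp
qed

lemma multi_additive_hd:
  assumes "multi_additive (Suc m) F" "length xs = m"
  shows "Modules.additive (\<lambda>z. F (z # xs))"
proof
  fix y w
  show "F ((y + w) # xs) = F (y # xs) + F (w # xs)"
    using assms(1)[unfolded multi_additive_def, rule_format, of "0 # xs" 0 y w] assms(2) by simp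
qed

lemma additive_of_nat_mult:
  fixes h :: "real \<Rightarrow> complex"
  assumes "Modules.additive h"
  shows "h (of_nat n * x) = of_nat n * h x"
proof -
  interpret Modules.additive h by fact
  show ?thesis by (induction n) (simp_all add: zero add distrib_right)
qed

lemma additive_Rats_mult:
  fixes h :: "real \<Rightarrow> complex"
  assumes "Modules.additive h" "q \<in> \<rat>"
  shows "h (q * x) = of_real q * h x"
proof -
  interpret Modules.additive h by fact
  have int: "h (of_int k * x) = of_int k * h x" for k x
    using additive_of_nat_mult[OF assms(1), of "nat \<bar>k\<bar>" x] minus[of "of_nat (nat \<bar>k\<bar>) * x"]
    by (cases "k \<ge> 0") auto
  obtain k l :: int where q: "q = of_int k / of_int l" and l: "l > 0"
    using assms(2) Rats_cases' by blast
  have "of_int l * (q * x) = of_int k * x" using q l by simp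
  then have "of_int l * h (q * x) = of_int k * h x"
    by (metis int)
  moreover have "of_int k = of_int l * complex_of_real q" using l by (simp add: q)
  ultimately have "of_int l * h (q * x) = of_int l * (of_real q * h x)" by (simp only: mult.assoc)
  then show ?thesis using l by simp
qed

lemma multi_additive_diag_scale:
  assumes "multi_additive m F" "q \<in> \<rat>"
  shows "F (replicate m (q * x)) = of_real q ^ m * F (replicate m x)"
  using assms(1)
proof (induction m arbitrary: F)
  case (Suc m)
  show ?case
    using Suc.IH[OF multi_additive_Cons[OF Suc.prems], of "q * x"]
      additive_Rats_mult[OF multi_additive_hd[OF Suc.prems] assms(2), of "replicate m x" x]
    by simp
qed simp

text \<open>Expanding by additivity, only the term with \<open>a\<close> in every slot grows like
  \<open>n ^ m\<close>. The induction peels off the first slot: with \<open>x\<close> there, the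
  quotient keeps a spare factor \<open>1 / n\<close>; with \<open>n * a\<close> there, the factor
  \<open>n\<close> cancels.\<close>

lemma multi_additive_diag_asymp:
  assumes "multi_additive m F"
  shows "(\<lambda>n. F (replicate m (x + of_nat n * a)) / of_nat n ^ m) \<longlonglongrightarrow> F (replicate m a)"
  using assms
proof (induction m arbitrary: F)
  case (Suc m)
  let ?r = "\<lambda>n. replicate m (x + of_nat n * a)"
  let ?A = "\<lambda>z n. F (z # ?r n) / of_nat n ^ m"
  have lim: "?A z \<longlonglongrightarrow> F (z # replicate m a)" for z
    using Suc.IH[OF multi_additive_Cons[OF Suc.prems]] .
  have "(\<lambda>n. ?A x n / of_nat n + ?A a n) \<longlonglongrightarrow> 0 + F (a # replicate m a)"
    by (intro tendsto_add lim tendsto_divide_0[OF lim] tendsto_of_nat)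
  moreover have "\<forall>\<^sub>F n in sequentially. ?A x n / of_nat n + ?A a n
      = F (replicate (Suc m) (x + of_nat n * a)) / of_nat n ^ Suc m"
  proof (rule eventually_sequentiallyI[of 1])
    fix n :: nat assume "1 \<le> n"
    have ad: "Modules.additive (\<lambda>z. F (z # ?r n))" by (rule multi_additive_hd[OF Suc.prems]) simp
    show "?A x n / of_nat n + ?A a n
      = F (replicate (Suc m) (x + of_nat n * a)) / of_nat n ^ Suc m"
      using Modules.additive.add[OF ad, of x "of_nat n * a"] additive_of_nat_mult[OF ad, of n a] \<open>1 \<le> n\<close>
      by (simp add: field_simps)
  qed
  ultimately show ?case by (simp add: tendsto_cong)
qed simp

lemma generalized_monomial_diag:
  assumes "generalized_monomial m f"
  obtains F where "multi_additive m F" "\<And>x. f x = F (replicate m x)"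
proof (cases "m = 0")
  case True
  with assms obtain c where "\<And>x. f x = c" by (auto simp: generalized_monomial_def)
  \<comment> \<open>With no argument slots additivity is vacuous, so a constant \<open>F\<close>
    serves in degree 0.\<close>
  with True show ?thesis by (intro that[of "\<lambda>_. c"]) (auto simp: multi_additive_def)
next
  case False
  with assms that show ?thesis by (auto simp: generalized_monomial_def)
qed

lemma generalized_monomial_scale:
  fixes f :: "real \<Rightarrow> real"
  assumes "generalized_monomial m (\<lambda>x. complex_of_real (f x))" "q \<in> \<rat>"
  shows "f (q * x) = q ^ m * f x"
proof -
  obtain F where F: "multi_additive m F" "\<And>x. complex_of_real (f x) = F (replicate m x)"
    using generalized_monomial_diag[OF assms(1)] by metis
  have "complex_of_real (f (q * x)) = complex_of_real (q ^ m * f x)"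
    using multi_additive_diag_scale[OF F(1) assms(2)] by (simp add: F(2))
  then show ?thesis by (simp only: of_real_eq_iff)
qed

lemma generalized_monomial_asymp:
  fixes f :: "real \<Rightarrow> real"
  assumes "generalized_monomial m (\<lambda>x. complex_of_real (f x))"
  shows "(\<lambda>n. f (x + of_nat n * a) / of_nat n ^ m) \<longlonglongrightarrow> f a"
proof -
  obtain F where F: "multi_additive m F" "\<And>x. complex_of_real (f x) = F (replicate m x)"
    using generalized_monomial_diag[OF assms] by metis
  have "(\<lambda>n. complex_of_real (f (x + of_nat n * a) / of_nat n ^ m)) \<longlonglongrightarrow> complex_of_real (f a)"
    using multi_additive_diag_asymp[OF F(1), of x a] by (simp add: F(2))
  then show ?thesis by (simp only: tendsto_of_real_iff)
qed

section \<open>Meager sets and the Baire property\<close>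

lemma nowhere_dense_empty [simp]: "nowhere_dense {}"
  by (simp add: nowhere_dense_def)

lemma nowhere_dense_subset: "nowhere_dense B \<Longrightarrow> A \<subseteq> B \<Longrightarrow> nowhere_dense A"
  unfolding nowhere_dense_def by (metis closure_mono interior_mono subset_empty)

text \<open>This boundary is the error made in replacing a closed set by its interior, as is done
  for complements in the Baire property.\<close>

lemma nowhere_dense_closed_diff_interior:
  assumes "closed A"
  shows "nowhere_dense (A - interior A)"
proof -
  have "interior (A - interior A) \<subseteq> interior A" by (intro interior_mono) auto
  moreover have "interior (A - interior A) \<subseteq> A - interior A" by (rule interior_subset)
  ultimately have "interior (A - interior A) = {}" by blast
  with assms show ?thesis by (simp add: nowhere_dense_def closed_Diff)
qed

lemma meager_setsE:
  assumes "A \<in> meager_sets"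
  obtains N :: "nat \<Rightarrow> 'a::topological_space set"
  where "\<And>n. nowhere_dense (N n)" "A = (\<Union>n. N n)"
  using assms unfolding meager_sets_def mem_Collect_eq by (elim exE conjE) (rule that, simp_all)

lemma meager_setsI:
  fixes N :: "nat \<Rightarrow> 'a::topological_space set"
  assumes "\<And>n. nowhere_dense (N n)" "A = (\<Union>n. N n)"
  shows "A \<in> meager_sets"
  unfolding meager_sets_def mem_Collect_eq using assms by (intro exI[of _ N]) simp

lemma meager_subset:
  assumes "B \<in> meager_sets" "A \<subseteq> B"
  shows "A \<in> meager_sets"
proof -
  obtain N where N: "\<And>n::nat. nowhere_dense (N n :: 'a set)" "B = (\<Union>n. N n)"
    using assms(1) by (metis meager_setsE)
  have "\<And>n. nowhere_dense (A \<inter> N n)" using nowhere_dense_subset[OF N(1)] by blast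
  moreover have "A = (\<Union>n. A \<inter> N n)" using assms(2) N(2) by blast
  ultimately show ?thesis by (rule meager_setsI)
qed

lemma nowhere_dense_imp_meager: "nowhere_dense A \<Longrightarrow> A \<in> meager_sets"
  by (rule meager_setsI[of "\<lambda>_. A"]) simp_all

lemma meager_UN_nat:
  assumes "\<And>n::nat. A n \<in> meager_sets"
  shows "(\<Union>n. A n) \<in> meager_sets"
proof -
  have "\<forall>n. \<exists>N. (\<forall>k. nowhere_dense (N k :: 'a set)) \<and> A n = (\<Union>k::nat. N k)"
    using assms by (simp add: meager_sets_def)
  then obtain N where N: "\<And>n k. nowhere_dense (N n k :: 'a set)" "\<And>n. A n = (\<Union>k::nat. N n k)"
    by metis
  let ?N = "\<lambda>j. N (fst (prod_decode j)) (snd (prod_decode j))"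
  have "(\<Union>n. A n) = (\<Union>j. ?N j)"
  proof (intro equalityI subsetI)
    fix x assume "x \<in> (\<Union>n. A n)"
    then obtain n k where "x \<in> N n k" using N(2) by blast
    then have "x \<in> ?N (prod_encode (n, k))" by simp
    then show "x \<in> (\<Union>j. ?N j)" by blast
  qed (use N(2) in blast)
  with N(1) show ?thesis by (rule meager_setsI)
qed

lemma meager_UN:
  assumes "countable I" "\<And>i. i \<in> I \<Longrightarrow> A i \<in> meager_sets"
  shows "(\<Union>i\<in>I. A i) \<in> meager_sets"
proof (cases "I = {}")
  case False
  have "(\<Union>n. A (from_nat_into I n)) \<in> meager_sets"
    by (intro meager_UN_nat assms(2) from_nat_into False)
  moreover have "(\<Union>n. A (from_nat_into I n)) = \<Union> (A ` range (from_nat_into I))"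
    by (simp add: image_image)
  ultimately show ?thesis using range_from_nat_into[OF False assms(1)] by simp
qed (simp add: nowhere_dense_imp_meager)

lemma meager_Un: "A \<in> meager_sets \<Longrightarrow> B \<in> meager_sets \<Longrightarrow> A \<union> B \<in> meager_sets"
  using meager_UN[of "{A, B}" "\<lambda>X. X"] by auto

text \<open>Needed for translations and for multiplication by nonzero rationals.\<close>

lemma meager_homeomorphic_vimage:
  fixes g h :: "'a::topological_space \<Rightarrow> 'a"
  assumes g: "continuous_on UNIV g" and h: "continuous_on UNIV h"
    and gh: "\<And>x. g (h x) = x" "\<And>x. h (g x) = x" and A: "A \<in> meager_sets"
  shows "g -` A \<in> meager_sets"
proof -
  have nd: "nowhere_dense (g -` N)" if "nowhere_dense N" for N
  proof -
    let ?U = "interior (closure (g -` N))"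
    have "closure (g -` N) \<subseteq> g -` closure N"
      by (rule closure_minimal)
        (use closure_subset g in \<open>auto simp: continuous_on_closed_vimage closed_vimage\<close>)
    \<comment> \<open>The preimage of \<open>?U\<close> under \<open>h\<close> is its image under
      \<open>g\<close>, an open set inside the closure of \<open>N\<close>.\<close>
    then have "h -` ?U \<subseteq> closure N"
      using interior_subset gh(1) by fastforce
    moreover have "open (h -` ?U)" using h by (simp add: open_vimage)
    ultimately have "h -` ?U = {}"
      using that interior_maximal unfolding nowhere_dense_def by blast
    then have "?U = {}" using gh(2) by (metis empty_iff equals0I vimageI)
    then show ?thesis by (simp add: nowhere_dense_def)
  qed
  obtain N where N: "\<And>n::nat. nowhere_dense (N n :: 'a set)" "A = (\<Union>n. N n)"
    using A by (metis meager_setsE)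
  have "g -` A = (\<Union>n. g -` N n)" using N(2) by blast
  with nd[OF N(1)] show ?thesis by (rule meager_setsI)
qed

text \<open>Baire category: the complements of the closures of the pieces are open and dense, so
  their intersection is dense, yet it misses \<open>U\<close>.\<close>

lemma open_meager_imp_empty:
  fixes U :: "'a::{real_normed_vector, heine_borel} set"
  assumes "open U" "U \<in> meager_sets"
  shows "U = {}"
proof -
  obtain N where N: "\<And>n::nat. nowhere_dense (N n)" "U = (\<Union>n. N n)"
    using assms(2) by (metis meager_setsE)
  have "UNIV \<subseteq> closure (\<Inter>n. - closure (N n))"
    by (rule Baire) (use N(1) in \<open>auto simp: closure_complement nowhere_dense_def\<close>)
  moreover have "U \<inter> (\<Inter>n. - closure (N n)) = {}"
    using N(2) closure_subset by fastforce
  ultimately show ?thesis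
    using open_Int_closure_eq_empty[OF assms(1)] by (metis inf_top_right top.extremum_unique)
qed

definition baire_property :: "'a::topological_space set \<Rightarrow> bool" where
  "baire_property A \<longleftrightarrow> (\<exists>U. open U \<and> (A - U) \<union> (U - A) \<in> meager_sets)"

text \<open>Sets that are open modulo a meager set form a sigma-algebra. For a complement, take the
  interior of the closed set \<open>- U\<close>, at the cost of a nowhere dense boundary; for a
  countable union, take the union of the open sets.\<close>

lemma baire_property_borel:
  assumes "A \<in> sets borel"
  shows "baire_property A"
  using assms unfolding sets_borel
proof (induction rule: sigma_sets.induct)
  case (Basic A)
  then show ?case unfolding baire_property_def
    by (intro exI[of _ A]) (auto simp: nowhere_dense_imp_meager)
next
  case Empty
  show ?case unfolding baire_property_def
    by (intro exI[of _ "{}"]) (auto simp: nowhere_dense_imp_meager)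
next
  case (Compl A)
  then obtain U where U: "open U" "(A - U) \<union> (U - A) \<in> meager_sets"
    by (auto simp: baire_property_def)
  let ?C = "- U" and ?V = "interior (- U)"
  have "?C - ?V \<in> meager_sets"
    using U(1) by (intro nowhere_dense_imp_meager nowhere_dense_closed_diff_interior) auto
  then have "(?C - ?V) \<union> ((A - U) \<union> (U - A)) \<in> meager_sets"
    using U(2) by (rule meager_Un)
  moreover have "((UNIV - A) - ?V) \<union> (?V - (UNIV - A)) \<subseteq> (?C - ?V) \<union> ((A - U) \<union> (U - A))"
    using interior_subset[of "- U"] by auto
  ultimately show ?case unfolding baire_property_def
    by (intro exI[of _ ?V]) (auto intro: meager_subset)
next
  case (Union A)
  then obtain U where U: "\<And>n. open (U n)" "\<And>n. (A n - U n) \<union> (U n - A n) \<in> meager_sets"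
    unfolding baire_property_def by metis
  have "(\<Union>n. (A n - U n) \<union> (U n - A n)) \<in> meager_sets" by (rule meager_UN_nat) (rule U)
  moreover have "((\<Union>n. A n) - (\<Union>n. U n)) \<union> ((\<Union>n. U n) - (\<Union>n. A n))
      \<subseteq> (\<Union>n. (A n - U n) \<union> (U n - A n))" by auto
  ultimately show ?case unfolding baire_property_def
    using U(1) by (intro exI[of _ "\<Union>n. U n"]) (auto intro: meager_subset)
qed

section \<open>Sections of Borel sets and their category\<close>

lemma borel_section:
  fixes D :: "('a::topological_space \<times> 'b::topological_space) set"
  assumes "D \<in> sets borel"
  shows "{y. (x, y) \<in> D} \<in> sets borel"
proof -
  have "Pair x \<in> borel_measurable borel"
    by (intro borel_measurable_continuous_onI continuous_intros)
  from measurable_sets[OF this assms] show ?thesis by (simp add: vimage_def)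
qed

text \<open>
  Montgomery--Novikov. Localizing to all open \<open>U\<close> makes the induction pass through complements:
  by the Baire property, the complement of a section is non-meager in \<open>U\<close> iff the section is
  meager in some nonempty basic open subset of \<open>U\<close>.
\<close>

lemma nonmeager_sections_borel_localized:
  fixes D :: "('a::topological_space \<times> 'b::{real_normed_vector, heine_borel, second_countable_topology}) set"
  assumes "D \<in> sets borel" "open U"
  shows "{x. {y \<in> U. (x, y) \<in> D} \<notin> meager_sets} \<in> sets borel"
  using assms unfolding sets_borel[where 'a = "'a \<times> 'b"]
proof (induction arbitrary: U rule: sigma_sets.induct)
  case (Basic D)
  then have D: "open D" by simp
  \<comment> \<open>Sections of an open set are open, hence by Baire category non-meager exactly
    when nonempty; what remains is a projection.\<close>
  have "{x. {y \<in> U. (x, y) \<in> D} \<notin> meager_sets} = (\<Union>y\<in>U. (\<lambda>x. (x, y)) -` D)"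
  proof -
    have "{y \<in> U. (x, y) \<in> D} \<notin> meager_sets \<longleftrightarrow> {y \<in> U. (x, y) \<in> D} \<noteq> {}" for x
    proof -
      have "{y \<in> U. (x, y) \<in> D} = U \<inter> Pair x -` D" by auto
      moreover have "open (U \<inter> Pair x -` D)"
        using D Basic.prems by (intro open_Int open_vimage continuous_intros)
      ultimately show ?thesis
        using open_meager_imp_empty nowhere_dense_imp_meager nowhere_dense_empty by metis
    qed
    then show ?thesis by auto
  qed
  moreover have "open (\<Union>y\<in>U. (\<lambda>x. (x, y)) -` D)"
    using D by (intro open_UN ballI open_vimage continuous_intros)
  ultimately show ?case by simp
next
  case Empty
  then show ?case by (simp add: nowhere_dense_imp_meager)
next
  case (Compl D)
  obtain \<B> :: "'b set set" where \<B>: "countable \<B>" "topological_basis \<B>"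
    using ex_countable_basis by blast
  let ?G = "{V \<in> \<B>. V \<noteq> {} \<and> V \<subseteq> U}"
  have D: "D \<in> sets borel" using Compl.hyps by (simp add: sets_borel)
  have "{x. {y \<in> U. (x, y) \<in> UNIV - D} \<notin> meager_sets}
      = (\<Union>V\<in>?G. - {x. {y \<in> V. (x, y) \<in> D} \<notin> meager_sets})"
  proof (rule set_eqI)
    fix x
    let ?S = "{y. (x, y) \<in> UNIV - D}"
    have "U \<inter> ?S \<notin> meager_sets \<longleftrightarrow> (\<exists>V\<in>?G. V - ?S \<in> meager_sets)"
    proof
      assume nm: "U \<inter> ?S \<notin> meager_sets"
      have "?S \<in> sets borel" using D by (intro borel_section) auto
      then obtain W where W: "open W" "(?S - W) \<union> (W - ?S) \<in> meager_sets"
        using baire_property_borel unfolding baire_property_def by blast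
      have "U \<inter> W \<noteq> {}"
      proof
        assume "U \<inter> W = {}"
        then have "U \<inter> ?S \<subseteq> (?S - W) \<union> (W - ?S)" by blast
        with nm W(2) meager_subset show False by blast
      qed
      then obtain y where y: "y \<in> U \<inter> W" by blast
      obtain V where V: "V \<in> \<B>" "y \<in> V" "V \<subseteq> U \<inter> W"
        using topological_basisE[OF \<B>(2), of "U \<inter> W" y] y W(1) Compl.prems by blast
      have "V - ?S \<in> meager_sets" by (rule meager_subset[OF W(2)]) (use V in auto)
      then show "\<exists>V\<in>?G. V - ?S \<in> meager_sets" using V by blast
    next
      assume "\<exists>V\<in>?G. V - ?S \<in> meager_sets"
      then obtain V where V: "V \<in> \<B>" "V \<noteq> {}" "V \<subseteq> U" "V - ?S \<in> meager_sets" by blast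
      show "U \<inter> ?S \<notin> meager_sets"
      proof
        assume "U \<inter> ?S \<in> meager_sets"
        then have "(U \<inter> ?S) \<union> (V - ?S) \<in> meager_sets" using V(4) by (rule meager_Un)
        then have "V \<in> meager_sets" by (rule meager_subset) (use V(3) in auto)
        then show False
          using open_meager_imp_empty topological_basis_open[OF \<B>(2) V(1)] V(2) by blast
      qed
    qed
    moreover have "{y \<in> U. (x, y) \<in> UNIV - D} = U \<inter> ?S" by auto
    moreover have "V - ?S = {y \<in> V. (x, y) \<in> D}" for V by auto
    ultimately show "x \<in> {x. {y \<in> U. (x, y) \<in> UNIV - D} \<notin> meager_sets} \<longleftrightarrow>
        x \<in> (\<Union>V\<in>?G. - {x. {y \<in> V. (x, y) \<in> D} \<notin> meager_sets})" by auto
  qed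
  \<comment> \<open>The basis is countable, and the induction hypothesis covers each of its members
    because they are open.\<close>
  moreover have "(\<Union>V\<in>?G. - {x. {y \<in> V. (x, y) \<in> D} \<notin> meager_sets}) \<in> sets borel"
    using \<B> Compl.IH topological_basis_open by (intro sets.countable_UN'' borel_comp) auto
  ultimately show ?case by simp
next
  case (Union D)
  have "{x. {y \<in> U. (x, y) \<in> (\<Union>n. D n)} \<notin> meager_sets}
      = (\<Union>n. {x. {y \<in> U. (x, y) \<in> D n} \<notin> meager_sets})"
  proof -
    have "{y \<in> U. (x, y) \<in> (\<Union>n. D n)} \<in> meager_sets
        \<longleftrightarrow> (\<forall>n. {y \<in> U. (x, y) \<in> D n} \<in> meager_sets)" for x
    proof -
      have "{y \<in> U. (x, y) \<in> (\<Union>n. D n)} = (\<Union>n. {y \<in> U. (x, y) \<in> D n})" by auto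
      then show ?thesis
        by (metis (no_types, lifting) UNIV_I UN_upper meager_UN_nat meager_subset)
    qed
    then show ?thesis by auto
  qed
  then show ?case using Union by auto
qed

lemma nonmeager_sections_borel:
  fixes D :: "('a::topological_space \<times> 'b::{real_normed_vector, heine_borel, second_countable_topology}) set"
  assumes "D \<in> sets borel"
  shows "{x. {y. (x, y) \<in> D} \<notin> meager_sets} \<in> sets borel"
  using nonmeager_sections_borel_localized[OF assms open_UNIV] by simp

section \<open>Ideals with a multiplicative zero-one law\<close>

text \<open>One inclusion suffices, as the nonzero rationals form a group. Negative factors are
  included, so invariant sets are symmetric about 0.\<close>

definition rat_mult_invariant :: "real set \<Rightarrow> bool" where
  "rat_mult_invariant E \<longleftrightarrow> (\<forall>q\<in>\<rat> - {0}. \<forall>x\<in>E. q * x \<in> E)"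

lemma rat_mult_invariant_iff:
  assumes "rat_mult_invariant E" "q \<in> \<rat> - {0}"
  shows "q * x \<in> E \<longleftrightarrow> x \<in> E"
proof
  assume "q * x \<in> E"
  moreover have "1 / q \<in> \<rat> - {0}" using assms(2) by auto
  ultimately have "1 / q * (q * x) \<in> E"
    using assms(1) unfolding rat_mult_invariant_def by blast
  then show "x \<in> E" using assms(2) by simp
qed (use assms in \<open>auto simp: rat_mult_invariant_def\<close>)

text \<open>Common interface to meager and null sets, which lets one argument treat both orders of
  the Fubini product. The axiom \<open>zero_one\<close> is ergodicity of the multiplicative action
  of the nonzero rationals.\<close>

locale zero_one_ideal =
  fixes I :: "real set set"
  assumes subset: "A \<in> I \<Longrightarrow> B \<subseteq> A \<Longrightarrow> B \<in> I"
    and UN: "(\<And>n::nat. S n \<in> I) \<Longrightarrow> (\<Union>n. S n) \<in> I"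
    and translate: "A \<in> I \<Longrightarrow> {x. x + c \<in> A} \<in> I"
    and proper: "UNIV \<notin> I"
    and zero_one: "E \<in> sets borel \<Longrightarrow> rat_mult_invariant E \<Longrightarrow> E \<notin> I \<Longrightarrow> - E \<in> I"
begin

text \<open>For each \<open>n\<close>, the starting points whose \<open>n\<close>-th term misses
  \<open>S\<close> form a translate of \<open>- S\<close>; countably many such translates cannot
  cover the line.\<close>

lemma ex_progression:
  assumes "- S \<in> I"
  obtains x where "\<And>n::nat. x + of_nat n * a \<in> S"
proof -
  have "(\<Union>n::nat. {x. x + of_nat n * a \<in> - S}) \<in> I"
    by (intro UN translate assms)
  then have "(\<Union>n::nat. {x. x + of_nat n * a \<in> - S}) \<noteq> UNIV" using proper by metis
  then show ?thesis using that by auto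
qed

lemma ex_same_sign:
  fixes f :: "real \<Rightarrow> real"
  assumes f: "generalized_monomial m (\<lambda>x. complex_of_real (f x))" and "- S \<in> I" and "f a \<noteq> 0"
  obtains x where "x \<in> S" "f x * f a > 0"
proof -
  obtain x where x: "\<And>n::nat. x + of_nat n * a \<in> S" using ex_progression[OF assms(2)] by blast
  \<comment> \<open>The extra factor \<open>f a\<close> turns agreement of signs into positivity,
    whichever sign \<open>f a\<close> has.\<close>
  have "(\<lambda>n. f (x + of_nat n * a) / of_nat n ^ m * f a) \<longlonglongrightarrow> f a * f a"
    by (intro tendsto_mult generalized_monomial_asymp[OF f] tendsto_const)
  moreover have "f a * f a > 0" using assms(3) by (simp add: zero_less_mult_iff) linarith
  ultimately have "\<forall>\<^sub>F n in sequentially. f (x + of_nat n * a) / of_nat n ^ m * f a > 0"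
    by (rule order_tendstoD)
  then obtain n where "f (x + of_nat n * a) / of_nat n ^ m * f a > 0"
    by (meson eventually_happens' sequentially_bot)
  then have "f (x + of_nat n * a) * f a > 0"
    by (auto simp: zero_less_mult_iff zero_less_divide_iff divide_less_0_iff)
  with x that show ?thesis by blast
qed

end

section \<open>The zero-one law for meager sets\<close>

lemma ex_rat_mult_in_open:
  fixes W :: "real set"
  assumes "open W" "W \<noteq> {}" "u \<noteq> 0"
  obtains q where "q \<in> \<rat> - {0}" "q * u \<in> W"
proof -
  \<comment> \<open>Removing 0 from \<open>W\<close> forces the rational found in \<open>?T\<close>
    to be nonzero; since singletons are not open, something of \<open>W\<close> remains.\<close>
  let ?T = "(\<lambda>x. x * u) -` (W - {0})"
  have "W - {0} \<noteq> {}"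
    using assms(1,2) not_open_singleton[of "0::real"] by (metis Diff_eq_empty_iff subset_singletonD)
  then obtain w where "w \<in> W - {0}" by blast
  then have "w / u \<in> ?T" using assms(3) by simp
  then have "?T \<noteq> {}" by blast
  moreover have "open ?T" using assms(1) by (intro open_vimage open_delete continuous_intros)
  ultimately have "?T \<inter> \<rat> \<noteq> {}"
    using open_Int_closure_eq_empty[of ?T \<rat>] by (simp only: Rats_closure_real Int_UNIV_right simp_thms)
  then obtain q where "q \<in> \<rat>" "q * u \<in> W - {0}" by blast
  with that show ?thesis by auto
qed

text \<open>For the zero-one law, \<open>E\<close> agrees with a nonempty open \<open>U\<close>
  modulo a meager set. The union \<open>?V\<close> of all rational rescalings of \<open>U\<close> is
  open, and it is dense because nonzero points have dense orbits. By invariance, \<open>E\<close>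
  contains \<open>?V\<close> up to a meager set.\<close>

lemma zero_one_ideal_meager: "zero_one_ideal meager_sets"
proof
  show "{x. x + c \<in> A} \<in> meager_sets" if "A \<in> meager_sets" for A and c :: real
    using meager_homeomorphic_vimage[of "\<lambda>x. x + c" "\<lambda>x. x - c" A] that
    by (simp add: vimage_def continuous_intros)
  show "(UNIV :: real set) \<notin> meager_sets" using open_meager_imp_empty[of "UNIV :: real set"] by auto
  show "- E \<in> meager_sets"
    if E: "E \<in> sets borel" "rat_mult_invariant E" "E \<notin> meager_sets" for E
  proof -
    obtain U where U: "open U" "(E - U) \<union> (U - E) \<in> meager_sets"
      using baire_property_borel[OF E(1)] unfolding baire_property_def by blast
    have "U \<noteq> {}" using U(2) E(3) by auto
    then have "\<not> U \<subseteq> {0}" using U(1) not_open_singleton[of "0::real"] by (metis subset_singletonD)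
    then obtain u where u: "u \<in> U" "u \<noteq> 0" by blast
    let ?Q = "\<rat> - {0::real}"
    let ?V = "\<Union>q\<in>?Q. (\<lambda>x. q * x) -` U"
    have "(\<lambda>x. q * x) -` (U - E) \<in> meager_sets" if "q \<in> ?Q" for q
      by (rule meager_homeomorphic_vimage[where h = "\<lambda>x. x / q"])
        (use that U(2) in \<open>auto intro!: continuous_intros intro: meager_subset\<close>)
    then have P: "(\<Union>q\<in>?Q. (\<lambda>x. q * x) -` (U - E)) \<in> meager_sets"
      by (intro meager_UN) (auto simp: countable_rat)
    have "open ?V" using U(1) by (intro open_UN ballI open_vimage continuous_intros)
    have "interior (- ?V) = {}"
    proof (rule ccontr)
      assume "interior (- ?V) \<noteq> {}"
      then obtain q where q: "q \<in> ?Q" "q * u \<in> interior (- ?V)"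
        using ex_rat_mult_in_open[OF open_interior _ u(2)] by blast
      then have "q * u \<notin> ?V" using interior_subset by blast
      \<comment> \<open>Scaling \<open>q * u\<close> back by \<open>1 / q\<close> returns to
        \<open>u\<close> in \<open>U\<close>, so \<open>q * u\<close> lies in \<open>?V\<close>
        after all.\<close>
      moreover have "1 / q \<in> ?Q" "q * u \<in> (\<lambda>x. 1 / q * x) -` U" using q(1) u(1) by auto
      ultimately show False by blast
    qed
    moreover have "closure (- ?V) = - ?V" using \<open>open ?V\<close> by (simp only: closure_closed closed_Compl)
    ultimately have "- ?V \<in> meager_sets"
      by (intro nowhere_dense_imp_meager) (simp only: nowhere_dense_def)
    then have "- ?V \<union> (\<Union>q\<in>?Q. (\<lambda>x. q * x) -` (U - E)) \<in> meager_sets" using P by (rule meager_Un)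
    \<comment> \<open>A point of \<open>?V\<close> outside \<open>E\<close> is carried into
      \<open>U\<close> by some \<open>q\<close>, and by invariance it stays outside
      \<open>E\<close>.\<close>
    then show ?thesis
      by (rule meager_subset) (use rat_mult_invariant_iff[OF E(2)] in auto)
  qed
qed (auto intro: meager_subset meager_UN_nat)

section \<open>The zero-one law for Lebesgue null sets\<close>

lemma emeasure_lborel_scale:
  fixes c :: real
  assumes "c \<noteq> 0" "A \<in> sets borel"
  shows "emeasure lborel A = ennreal \<bar>c\<bar> * emeasure lborel {x. c * x \<in> A}"
proof -
  have "emeasure lborel A = (\<integral>\<^sup>+x. indicator A x \<partial>lborel)" using assms(2) by simp
  also have "\<dots> = ennreal \<bar>c\<bar> * (\<integral>\<^sup>+x. indicator A (0 + c * x) \<partial>lborel)"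
    using assms by (intro nn_integral_real_affine) auto
  also have "(\<lambda>x. indicator A (0 + c * x) :: ennreal) = indicator {x. c * x \<in> A}"
    by (auto simp: indicator_def)
  also have "(\<integral>\<^sup>+x. indicator {x. c * x \<in> A} x \<partial>lborel) = emeasure lborel {x. c * x \<in> A}"
    using measurable_sets[of "\<lambda>x. c * x" borel borel, OF _ assms(2)]
    by (intro nn_integral_indicator) (simp only: vimage_def space_borel Int_UNIV_right sets_lborel, simp)
  finally show ?thesis .
qed

text \<open>Monotonicity squeezes \<open>g t\<close> between the values at rationals just below and
  just above \<open>t\<close>.\<close>

lemma mono_rat_homogeneous_imp_linear:
  fixes g :: "real \<Rightarrow> real"
  assumes mono: "\<And>s t. 0 \<le> s \<Longrightarrow> s \<le> t \<Longrightarrow> g s \<le> g t"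
    and hom: "\<And>q. q \<in> \<rat> \<Longrightarrow> 0 < q \<Longrightarrow> g q = q * c"
    and "0 < t"
  shows "g t = t * c"
proof (rule antisym)
  show "g t \<le> t * c"
  proof (rule ccontr)
    assume *: "\<not> g t \<le> t * c"
    have "((\<lambda>s. s * c) \<longlongrightarrow> t * c) (at_right t)" by (intro tendsto_intros)
    then have "\<forall>\<^sub>F s in at_right t. s * c < g t" using * by (intro order_tendstoD) auto
    then obtain b where b: "b > t" "\<And>s. t < s \<Longrightarrow> s < b \<Longrightarrow> s * c < g t"
      unfolding eventually_at_right_field by blast
    obtain q where "q \<in> \<rat>" "t < q" "q < b" using Rats_dense_in_real[OF b(1)] by blast
    with b(2)[of q] hom[of q] mono[of t q] assms(3) show False by auto
  qed
  show "t * c \<le> g t"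
  proof (rule ccontr)
    assume *: "\<not> t * c \<le> g t"
    have "((\<lambda>s. s * c) \<longlongrightarrow> t * c) (at_left t)" by (intro tendsto_intros)
    then have "\<forall>\<^sub>F s in at_left t. s * c > g t" using * by (intro order_tendstoD) auto
    then obtain b where b: "b < t" "\<And>s. b < s \<Longrightarrow> s < t \<Longrightarrow> s * c > g t"
      unfolding eventually_at_left_field by blast
    \<comment> \<open>The maximum with 0 keeps the rational positive, as homogeneity is assumed only
      there.\<close>
    obtain q where "q \<in> \<rat>" "max b 0 < q" "q < t"
      using Rats_dense_in_real[of "max b 0" t] b(1) assms(3) by auto
    with b(2)[of q] hom[of q] mono[of q t] assms(3) show False by auto
  qed
qed

text \<open>
  By invariance, \<open>t \<mapsto> \<lambda>(E \<inter> [0,t])\<close> is homogeneous over the positive rationals, and being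
  monotone it is linear. So \<open>E\<close> has the same density in every interval.
\<close>

lemma rat_mult_invariant_density:
  assumes E: "E \<in> sets borel" "rat_mult_invariant E"
  obtains c where "c \<ge> 0"
    "\<And>l u. l \<le> u \<Longrightarrow> emeasure lborel (E \<inter> {l..u}) = ennreal (c * (u - l))"
proof -
  define h where "h l u = measure lborel (E \<inter> {l..u})" for l u
  have fin: "E \<inter> {l..u} \<in> fmeasurable lborel" for l u
  proof -
    have "{l..u} \<in> fmeasurable lborel"
      by (intro fmeasurableI) (simp_all add: emeasure_lborel_Icc_eq)
    then show ?thesis using E(1) fmeasurable_Int_fmeasurable[of "{l..u}" lborel E]
      by (simp only: Int_commute[of E] sets_lborel)
  qed
  have em: "emeasure lborel (E \<inter> {l..u}) = ennreal (h l u)" for l u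
    unfolding h_def using fin by (simp add: emeasure_eq_measure2)
  have h_nonneg: "h l u \<ge> 0" for l u by (simp add: h_def)
  have scale: "h (q * l) (q * u) = q * h l u" if "q \<in> \<rat>" "q > 0" for q l u
  proof -
    have "{x. q * x \<in> E \<inter> {q * l..q * u}} = E \<inter> {l..u}"
      using that rat_mult_invariant_iff[OF E(2), of q] by auto
    then have "ennreal (h (q * l) (q * u)) = ennreal (q * h l u)"
      using emeasure_lborel_scale[of q "E \<inter> {q * l..q * u}"] E(1) that
      by (simp add: em ennreal_mult h_nonneg)
    then show ?thesis using that by (simp add: h_nonneg)
  qed
  \<comment> \<open>The factor \<open>- 1\<close> is a nonzero rational; this reflection carries the
    result from the right half-line to the left.\<close>
  have refl: "h (- u) (- l) = h l u" for l u
  proof -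
    have "{x. - 1 * x \<in> E \<inter> {- u..- l}} = E \<inter> {l..u}"
      using rat_mult_invariant_iff[OF E(2), of "- 1"] by auto
    then have "ennreal (h (- u) (- l)) = ennreal (h l u)"
      using emeasure_lborel_scale[of "- 1" "E \<inter> {- u..- l}"] E(1)
      by (simp add: em)
    then show ?thesis by (simp add: h_nonneg)
  qed
  have split: "h l u = h l k + h k u" if "l \<le> k" "k \<le> u" for l k u
  proof -
    have "E \<inter> {l..u} = (E \<inter> {l..k}) \<union> (E \<inter> {k..u})" using that by auto
    \<comment> \<open>The two pieces may share the endpoint \<open>k\<close>, so they are disjoint
      only almost everywhere.\<close>
    moreover have "AE x in lborel. x \<notin> E \<inter> {l..k} \<or> x \<notin> E \<inter> {k..u}"
      using AE_lborel_singleton[of k] by eventually_elim auto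
    then have "measure lborel (E \<inter> {l..k} \<union> E \<inter> {k..u}) = h l k + h k u"
      unfolding h_def by (rule measure_Un_AE[OF _ fin fin])
    ultimately show ?thesis by (simp only: h_def)
  qed
  define c where "c = h 0 1"
  have h0: "h 0 t = t * c" if "t > 0" for t
  proof (rule mono_rat_homogeneous_imp_linear[OF _ _ that])
    show "h 0 s \<le> h 0 t" if "0 \<le> s" "s \<le> t" for s t
      using split[of 0 s t] h_nonneg[of s t] that by simp
    show "h 0 q = q * c" if "q \<in> \<rat>" "0 < q" for q
      using scale[OF that, of 0 1] by (simp add: c_def)
  qed
  have h00: "h 0 0 = 0" using split[of 0 0 0] by simp
  have h0: "h 0 t = t * c" if "t \<ge> 0" for t
    using h0[of t] h00 that by (cases "t = 0") auto
  have pos: "h l u = c * (u - l)" if "0 \<le> l" "l \<le> u" for l u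
    using split[of 0 l u] h0[of l] h0[of u] that by (simp add: algebra_simps)
  have "h l u = c * (u - l)" if "l \<le> u" for l u
  proof -
    consider "0 \<le> l" | "u \<le> 0" | "l \<le> 0" "0 \<le> u" by linarith
    then show ?thesis
    proof cases
      case 1 then show ?thesis using pos that by simp
    next
      case 2 then show ?thesis using pos[of "- u" "- l"] refl[of u l] that by (simp add: algebra_simps)
    next
      case 3 then show ?thesis
        using pos[of 0 "- l"] refl[of 0 l] pos[of 0 u] split[of l 0 u] by (simp add: algebra_simps)
    qed
  qed
  moreover have "c \<ge> 0" by (simp add: c_def h_nonneg)
  ultimately show ?thesis using that em by simp
qed

text \<open>For the zero-one law, a non-null \<open>E\<close> has a constant positive density
  \<open>c\<close>. Lebesgue measure restricted to \<open>E\<close> and divided by \<open>c\<close>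
  then agrees with Lebesgue measure on intervals, hence everywhere; as it vanishes on
  \<open>- E\<close>, that set is null.\<close>

lemma zero_one_ideal_null: "zero_one_ideal (null_sets lebesgue)"
proof
  show "B \<in> null_sets lebesgue" if "A \<in> null_sets lebesgue" "B \<subseteq> A" for A B :: "real set"
    using that by (rule null_sets_completion_subset[rotated])
  show "{x. x + c \<in> A} \<in> null_sets lebesgue" if "A \<in> null_sets lebesgue" for A and c :: real
  proof -
    have "{x. x + c \<in> A} = (\<lambda>x. - c + x) ` A" by force
    then show ?thesis
      using negligible_translation[of A "- c"] that by (simp only: negligible_iff_null_sets)
  qed
  show "(UNIV :: real set) \<notin> null_sets lebesgue"
    by (simp add: null_sets_def emeasure_completion)
  show "- E \<in> null_sets lebesgue"
    if E: "E \<in> sets borel" "rat_mult_invariant E" "E \<notin> null_sets lebesgue" for E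
  proof -
    obtain c where c: "c \<ge> 0"
      "\<And>l u. l \<le> u \<Longrightarrow> emeasure lborel (E \<inter> {l..u}) = ennreal (c * (u - l))"
      using rat_mult_invariant_density[OF E(1,2)] by blast
    have "c \<noteq> 0"
    proof
      assume "c = 0"
      then have "E \<inter> {- real n..real n} \<in> null_sets lborel" for n
        using c(2)[of "- real n" "real n"] E(1) by (intro null_setsI) auto
      then have "(\<Union>n. E \<inter> {- real n..real n}) \<in> null_sets lborel" by (rule null_sets_UN)
      moreover have "(\<Union>n. E \<inter> {- real n..real n}) = E"
      proof -
        have "\<exists>n. x \<in> {- real n..real n}" for x
          using real_arch_simple[of "\<bar>x\<bar>"] by (auto simp: abs_le_iff minus_le_iff)
        then show ?thesis by blast
      qed
      ultimately show False using E(3) null_sets_completionI by metis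
    qed
    with c(1) have "c > 0" by simp
    define M where "M = scale_measure (ennreal (1 / c)) (density lborel (indicator E))"
    have sets_M: "sets M = sets borel" by (simp add: M_def)
    have M: "emeasure M A = ennreal (1 / c) * emeasure lborel (E \<inter> A)" if "A \<in> sets borel" for A
      using that E(1) by (simp add: M_def emeasure_restricted)
    have "lborel = M"
    proof (rule lborel_eqI)
      fix l u :: real assume "\<And>b. b \<in> Basis \<Longrightarrow> l \<bullet> b \<le> u \<bullet> b"
      then have lu: "l \<le> u" by simp
      \<comment> \<open>Uniqueness of Lebesgue measure is tested on open boxes, whereas the density
        is known on closed intervals.\<close>
      have "emeasure lborel (E \<inter> {l<..<u}) = emeasure lborel (E \<inter> {l..u})"
        using E(1) AE_lborel_singleton[of l] AE_lborel_singleton[of u]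
        by (intro emeasure_eq_AE) auto
      then show "emeasure M (box l u) = ennreal (\<Prod>b\<in>Basis. (u - l) \<bullet> b)"
        using lu \<open>c > 0\<close> by (simp add: M c(2) ennreal_mult[symmetric])
    qed (simp add: sets_M)
    then have "emeasure lborel (- E) = 0" using M[of "- E"] E(1) by simp
    then have "- E \<in> null_sets lborel" using E(1) by (intro null_setsI) auto
    then show ?thesis by (rule null_sets_completionI)
  qed
qed auto

text \<open>The measure of a section is a Borel function of \<open>x\<close>, and since sections are
  Borel, being null for the completion means having \<open>lborel\<close> measure 0.\<close>

lemma nonnull_sections_borel:
  fixes D :: "(real \<times> real) set"
  assumes "D \<in> sets borel"
  shows "{x. {y. (x, y) \<in> D} \<notin> null_sets lebesgue} \<in> sets borel"
proof -
  have "sets (borel \<Otimes>\<^sub>M lborel :: (real \<times> real) measure) = sets (borel \<Otimes>\<^sub>M borel)"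
    by (intro sets_pair_measure_cong) simp_all
  then have "D \<in> sets (borel \<Otimes>\<^sub>M lborel)" using assms by (simp only: borel_prod)
  then have "(\<lambda>x. emeasure lborel (Pair x -` D)) \<in> borel_measurable borel"
    by (rule lborel.measurable_emeasure_Pair)
  then have "{x. emeasure lborel (Pair x -` D) \<noteq> 0} \<in> sets borel" by measurable
  moreover have "{y. (x, y) \<in> D} \<notin> null_sets lebesgue \<longleftrightarrow> emeasure lborel (Pair x -` D) \<noteq> 0" for x
    using borel_section[OF assms, of x]
    by (auto simp: null_sets_def emeasure_completion vimage_def main_part_sets)
  ultimately show ?thesis by simp
qed

section \<open>The sign of a monomial of even degree\<close>

text \<open>Abstract ideals make both alternatives of the theorem instances. The hypothesis
  \<open>sec\<close> allows the zero-one law to be applied to the set \<open>X\<close> of large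
  sections.\<close>

lemma monomial_sign:
  fixes f :: "real \<Rightarrow> real"
  assumes I: "zero_one_ideal I" and J: "zero_one_ideal J"
    and sec: "\<And>B :: (real \<times> real) set. B \<in> sets borel \<Longrightarrow> {x. {y. (x, y) \<in> B} \<notin> J} \<in> sets borel"
    and f: "generalized_monomial m (\<lambda>x. complex_of_real (f x))" and m: "even m"
    and D: "D \<in> sets borel" "D \<notin> fubini_product I J" "\<forall>(x, y) \<in> D. f x * f y \<ge> 0"
  shows "f a * f b \<ge> 0"
proof (rule ccontr)
  assume neg: "\<not> f a * f b \<ge> 0"
  interpret I: zero_one_ideal I by fact
  interpret J: zero_one_ideal J by fact
  let ?Q = "\<rat> - {0::real}"
  \<comment> \<open>The factors \<open>p\<close> and \<open>q\<close> are independent, so that both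
    \<open>X\<close> and every vertical section of \<open>E\<close> become invariant.\<close>
  define E where "E = (\<Union>p\<in>?Q. \<Union>q\<in>?Q. (\<lambda>(x, y). (p * x, q * y)) -` D)"
  have E: "(x, y) \<in> E \<longleftrightarrow> (\<exists>p\<in>?Q. \<exists>q\<in>?Q. (p * x, q * y) \<in> D)" for x y
    by (simp only: E_def UN_iff vimage_eq case_prod_conv)
  have E_borel: "E \<in> sets borel"
  proof -
    have "(\<lambda>(x, y). (p * x, q * y)) -` D \<in> sets borel" for p q
    proof -
      have "(\<lambda>(x, y). (p * x, q * y)) \<in> borel_measurable borel"
        unfolding case_prod_beta by (intro borel_measurable_continuous_onI continuous_intros)
      from measurable_sets[OF this D(1)] show ?thesis by (simp only: space_borel Int_UNIV_right)
    qed
    then show ?thesis unfolding E_def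
      by (intro sets.countable_UN'' countable_Diff countable_rat)
  qed
  have E_mult: "(r * x, s * y) \<in> E" if xy: "(x, y) \<in> E" and rs: "r \<in> ?Q" "s \<in> ?Q" for x y r s
  proof -
    obtain p q where pq: "p \<in> ?Q" "q \<in> ?Q" "(p * x, q * y) \<in> D" using xy E by blast
    have "p / r \<in> ?Q" "q / s \<in> ?Q" using pq rs by simp_all
    moreover have "(p / r * (r * x), q / s * (s * y)) \<in> D" using pq rs by simp
    ultimately show ?thesis using E by blast
  qed
  have E_sign: "f x * f y \<ge> 0" if xy: "(x, y) \<in> E" for x y
  proof -
    obtain p q where pq: "p \<in> ?Q" "q \<in> ?Q" "(p * x, q * y) \<in> D" using xy E by blast
    then have "0 \<le> f (p * x) * f (q * y)" using D(3) by blast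
    also have "\<dots> = (p ^ m * q ^ m) * (f x * f y)"
      using pq generalized_monomial_scale[OF f, of p x] generalized_monomial_scale[OF f, of q y] by simp
    finally have "0 \<le> (p ^ m * q ^ m) * (f x * f y)" .
    \<comment> \<open>Evenness of \<open>m\<close> enters here: the powers are positive also for
      negative factors.\<close>
    moreover have "p ^ m * q ^ m > 0" using pq m by (simp add: zero_less_power_eq)
    ultimately show ?thesis using mult_le_cancel_left_pos[of "p ^ m * q ^ m" 0] by simp
  qed
  define X where "X = {x. {y. (x, y) \<in> E} \<notin> J}"
  \<comment> \<open>Otherwise \<open>E\<close>, a Borel superset of \<open>D\<close>, would witness
    that \<open>D\<close> lies in the Fubini product.\<close>
  have "X \<notin> I"
  proof
    assume "X \<in> I"
    have "D \<subseteq> E"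
    proof (intro subsetI, clarify)
      fix x y assume "(x, y) \<in> D"
      moreover have "1 \<in> ?Q" by simp
      ultimately show "(x, y) \<in> E" unfolding E by (metis mult_1)
    qed
    then have "D \<in> fubini_product I J"
      unfolding fubini_product_def using E_borel \<open>X \<in> I\<close> X_def by blast
    with D(2) show False by simp
  qed
  moreover have "rat_mult_invariant X"
    unfolding rat_mult_invariant_def
  proof (intro ballI)
    fix q x assume q: "q \<in> ?Q" and "x \<in> X"
    have "(q * x, y) \<in> E" if "(x, y) \<in> E" for y
      using E_mult[OF that q, of 1] by simp
    then have "{y. (x, y) \<in> E} \<subseteq> {y. (q * x, y) \<in> E}" by blast
    then show "q * x \<in> X" using \<open>x \<in> X\<close> J.subset unfolding X_def by blast
  qed
  moreover have "X \<in> sets borel" unfolding X_def by (rule sec) (rule E_borel)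
  ultimately have "- X \<in> I" using I.zero_one by blast
  moreover have "f a \<noteq> 0" "f b \<noteq> 0" using neg by auto
  ultimately obtain x where x: "x \<in> X" "f x * f a > 0"
    using I.ex_same_sign[OF f] by blast
  let ?Y = "{y. (x, y) \<in> E}"
  have "rat_mult_invariant ?Y"
    unfolding rat_mult_invariant_def
  proof (intro ballI)
    fix q y assume "q \<in> ?Q" "y \<in> ?Y"
    then show "q * y \<in> ?Y" using E_mult[of x y 1 q] by simp
  qed
  moreover have "?Y \<in> sets borel" using E_borel by (rule borel_section)
  ultimately have "- ?Y \<in> J" using J.zero_one x(1) by (auto simp: X_def)
  then obtain y where y: "y \<in> ?Y" "f y * f b > 0"
    using J.ex_same_sign[OF f] \<open>f b \<noteq> 0\<close> by blast
  have "f x * f y \<ge> 0" using y(1) E_sign by simp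
  \<comment> \<open>The signs of \<open>f x\<close> and \<open>f y\<close> are those of
    \<open>f a\<close> and \<open>f b\<close>, which are opposite.\<close>
  then show False
    using x(2) y(2) neg by (auto simp: zero_le_mult_iff zero_less_mult_iff)
qed

theorem theorem4p3:
  fixes f :: "real \<Rightarrow> real" and m :: nat and D :: "(real \<times> real) set"
  assumes "generalized_monomial m (\<lambda>x. complex_of_real (f x))"
    and "even m"
    and "D \<in> sets borel"
    and "D \<notin> fubini_product meager_sets (null_sets lebesgue) \<or>
         D \<notin> fubini_product (null_sets lebesgue) meager_sets"
    and "\<forall>(x, y) \<in> D. f x * f y \<ge> 0"
  shows "\<forall>x y. f x * f y \<ge> 0"
  using assms(4)
proof
  assume "D \<notin> fubini_product meager_sets (null_sets lebesgue)"
  then show ?thesis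
    using monomial_sign[OF zero_one_ideal_meager zero_one_ideal_null nonnull_sections_borel]
      assms by blast
next
  assume "D \<notin> fubini_product (null_sets lebesgue) meager_sets"
  then show ?thesis
    using monomial_sign[OF zero_one_ideal_null zero_one_ideal_meager nonmeager_sections_borel]
      assms by blast
qed

end
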